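(* Let $\mathcal{Q}\subset\mathbb{R}^n$ be compact and let $(\mathcal{E},\mathcal{D})$ be a compression code for $\mathcal{Q}$ operating at rate $r$ and distortion $\delta$, with codebook $\mathcal{C}$. Let $A\in\mathbb{R}^{d\times n}$ have i.i.d. $\mathcal{N}(0,1)$ entries and let ${\bf z}\sim\mathcal{N}(0,\sigma^2I_d)$ be independent of $A$. For ${\bf x}_o\in\mathcal{Q}$ let $\hat{{\bf x}}_o$ be any element of $\arg\min_{{\bf c}\in\mathcal{C}}\|A{\bf x}_o+{\bf z}-A{\bf c}\|_2^2$. Then for $\tau\in(0,1)$ and $t,\gamma>0$, the probability that there exists ${\bf x}_o\in\mathcal{Q}$ with \[ \|{\bf x}_o-\hat{{\bf x}}_o\|_2\ge\frac{2(\sqrt n+(t+1)\sqrt d)\delta+2\gamma\sigma}{\sqrt{(1-\tau)d}}+\delta \] is at most \[ {\rm e}^{-dt^2/2}+2^{2r}\big({\rm e}^{-\gamma^2/2}+{\rm e}^{\frac d2(\tau+\log(1-\tau))}\big). \]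
   Context: A compression code $(\mathcal{E},\mathcal{D})$ for $\mathcal{Q}$ at rate $r$ consists of an encoder $\mathcal{E}:\mathcal{Q}\to\{1,2,\dots,2^r\}$ and a decoder $\mathcal{D}:\{1,\dots,2^r\}\to\mathbb{R}^n$; its codebook is $\mathcal{C}=\{\mathcal{D}(\mathcal{E}({\bf x})):{\bf x}\in\mathcal{Q}\}$, and its distortion is $\delta=\sup_{{\bf x}\in\mathcal{Q}}\|{\bf x}-\mathcal{D}(\mathcal{E}({\bf x}))\|_2$. $\log$ is the natural logarithm. The probability is over $A$ and ${\bf z}$. *)

theory Defs
  imports "HOL-Analysis.Analysis" "HOL-Probability.Probability"
begin

definition gaussian_matrix_measure :: "('d::finite \<times> 'n::finite \<Rightarrow> real) measure" where
  "gaussian_matrix_measure = (\<Pi>\<^sub>M ij\<in>UNIV. density lborel std_normal_density)"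

definition gaussian_noise_measure :: "real \<Rightarrow> ('d::finite \<Rightarrow> real) measure" where
  "gaussian_noise_measure \<sigma> = (\<Pi>\<^sub>M i\<in>UNIV. density lborel (normal_density 0 \<sigma>))"

definition to_mat :: "('d::finite \<times> 'n::finite \<Rightarrow> real) \<Rightarrow> real^'n^'d" where
  "to_mat f = (\<chi> i j. f (i, j))"

definition to_vec :: "('d::finite \<Rightarrow> real) \<Rightarrow> real^'d" where
  "to_vec g = (\<chi> i. g i)"

definition is_compression_code :: "(real^'n) set \<Rightarrow> nat \<Rightarrow> (real^'n \<Rightarrow> nat) \<Rightarrow> (nat \<Rightarrow> real^'n) \<Rightarrow> bool" where
  "is_compression_code Q r E D \<longleftrightarrow> (\<forall>x\<in>Q. E x \<in> {1..2^r})"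

definition codebook :: "(real^'n) set \<Rightarrow> (real^'n \<Rightarrow> nat) \<Rightarrow> (nat \<Rightarrow> real^'n) \<Rightarrow> (real^'n) set" where
  "codebook Q E D = (\<lambda>x. D (E x)) ` Q"

definition distortion :: "(real^'n) set \<Rightarrow> (real^'n \<Rightarrow> nat) \<Rightarrow> (nat \<Rightarrow> real^'n) \<Rightarrow> real" where
  "distortion Q E D = (SUP x\<in>Q. norm (x - D (E x)))"

end

theory Submission
  imports Defs
begin

text \<open>
  Fix two codewords \<open>c \<noteq> c'\<close>, put \<open>u = (c - c') / |c - c'|\<close>, \<open>a = A u\<close>, \<open>w = a / |a|\<close>, and suppose that
  \<open>c'\<close> beats the codeword \<open>c\<close> of \<open>x\<close>. Expanding the squares gives
  \<open>|c - c'| |a| \<le> 2 \<delta> |A\<^sup>T w| - 2 \<langle>w, z\<rangle>\<close>, so if the error is large then \<open>|a|\<^sup>2 \<le> (1 - \<tau>) d\<close>, or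
  \<open>- \<langle>w, z\<rangle> \<ge> \<gamma> \<sigma>\<close>, or \<open>|A\<^sup>T w|\<close> is large compared with \<open>|a|\<close> although \<open>|a|\<^sup>2 \<ge> (1 - \<tau>) d\<close>.

  No bound on the largest singular value of \<open>A\<close> is used. By rotation invariance \<open>|A\<^sup>T w|\<^sup>2 - |a|\<^sup>2\<close> and
  \<open>|a|\<^sup>2\<close> are independent chi-square variables, and a joint Chernoff bound shows that the third event has
  probability at most \<open>p exp (- d t\<^sup>2 / 2)\<close>, where \<open>p = exp (d/2 (\<tau> + ln (1 - \<tau>)))\<close> is the bound for
  the first event. In the union bound over at most \<open>2 ^ (2 r)\<close> pairs this costs
  \<open>2 ^ (2 r) p exp (- d t\<^sup>2 / 2)\<close>, and the factor \<open>2 ^ (2 r) p\<close> may be assumed to be at most 1, since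
  otherwise the claim is trivial.
\<close>

section \<open>Exponential moments of a normal variable and of its square\<close>

text \<open>Completing the square: the factor \<open>exp (s * x)\<close> turns the density into a
  constant times the normal density with mean \<open>s * \<sigma>\<^sup>2\<close> and the same
  deviation, which integrates to 1.\<close>

lemma nn_integral_exp_normal:
  assumes "0 < \<sigma>"
  shows "(\<integral>\<^sup>+x. ennreal (exp (s * x)) \<partial>density lborel (normal_density 0 \<sigma>)) = ennreal (exp (s\<^sup>2 * \<sigma>\<^sup>2 / 2))"
proof -
  have eq: "normal_density 0 \<sigma> x * exp (s * x) = exp (s\<^sup>2 * \<sigma>\<^sup>2 / 2) * normal_density (s * \<sigma>\<^sup>2) \<sigma> x" for x
  proof -
    have "- (x - 0)\<^sup>2 / (2 * \<sigma>\<^sup>2) + s * x = s\<^sup>2 * \<sigma>\<^sup>2 / 2 - (x - s * \<sigma>\<^sup>2)\<^sup>2 / (2 * \<sigma>\<^sup>2)"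
      using assms by (simp add: field_simps power2_eq_square)
    then show ?thesis
      by (simp add: normal_density_def mult.left_commute flip: exp_add)
  qed
  have "(\<integral>\<^sup>+x. ennreal (exp (s * x)) \<partial>density lborel (normal_density 0 \<sigma>))
      = (\<integral>\<^sup>+x. ennreal (exp (s\<^sup>2 * \<sigma>\<^sup>2 / 2)) * ennreal (normal_density (s * \<sigma>\<^sup>2) \<sigma> x) \<partial>lborel)"
    by (simp add: nn_integral_density eq flip: ennreal_mult)
  also have "\<dots> = ennreal (exp (s\<^sup>2 * \<sigma>\<^sup>2 / 2))"
    using assms by (simp add: nn_integral_cmult nn_integral_eq_integral)
  finally show ?thesis .
qed

text \<open>Here the exponential factor changes the width instead of the mean: the product is a
  multiple of the centered normal density with variance \<open>1 / (1 - 2 * l)\<close>.\<close>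

lemma nn_integral_exp_square_std_normal:
  assumes "l < 1/2"
  shows "(\<integral>\<^sup>+x. ennreal (exp (l * x\<^sup>2)) \<partial>density lborel std_normal_density) = ennreal (1 / sqrt (1 - 2 * l))"
proof -
  define s where "s = 1 / sqrt (1 - 2 * l)"
  have s: "s > 0" "s\<^sup>2 = 1 / (1 - 2 * l)" using assms by (auto simp: s_def power_divide)
  have eq: "std_normal_density x * exp (l * x\<^sup>2) = s * normal_density 0 s x" for x
  proof -
    have "- x\<^sup>2 / 2 + l * x\<^sup>2 = - (x - 0)\<^sup>2 / (2 * s\<^sup>2)"
      using assms unfolding s by (simp add: field_simps)
    moreover have "1 / sqrt (2 * pi) = s * (1 / sqrt (2 * pi * s\<^sup>2))"
      using s(1) by (simp add: real_sqrt_mult)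
    ultimately show ?thesis
      by (simp add: normal_density_def std_normal_density_def flip: exp_add)
  qed
  have "(\<integral>\<^sup>+x. ennreal (exp (l * x\<^sup>2)) \<partial>density lborel std_normal_density)
      = (\<integral>\<^sup>+x. ennreal s * ennreal (normal_density 0 s x) \<partial>lborel)"
    using s(1) by (simp add: nn_integral_density eq flip: ennreal_mult)
  also have "\<dots> = ennreal s"
    using s(1) by (simp add: nn_integral_cmult nn_integral_eq_integral)
  finally show ?thesis by (simp add: s_def)
qed

section \<open>Exponential moments of Gaussian families\<close>

text \<open>On \<open>UNIV\<close> this is the law of the random matrix. The free index set allows
  the matrix to be split into one column and the others, and serves for auxiliary normal
  variables.\<close>

definition std_gaussian :: "'i set \<Rightarrow> ('i \<Rightarrow> real) measure" where
  "std_gaussian I = (\<Pi>\<^sub>M i\<in>I. density lborel std_normal_density)"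

lemma prob_space_std_gaussian: "prob_space (std_gaussian I)"
  unfolding std_gaussian_def by (intro prob_space_PiM prob_space_normal_density) simp

lemma sets_std_gaussian [measurable_cong]:
  "sets (std_gaussian I) = sets (\<Pi>\<^sub>M i\<in>I. borel)"
  unfolding std_gaussian_def by (intro sets_PiM_cong) auto

lemma nn_integral_std_gaussian_prod:
  assumes "finite I" "\<And>i. i \<in> I \<Longrightarrow> f i \<in> borel_measurable borel"
  shows "(\<integral>\<^sup>+x. (\<Prod>i\<in>I. f i (x i)) \<partial>std_gaussian I)
    = (\<Prod>i\<in>I. \<integral>\<^sup>+x. f i x \<partial>density lborel std_normal_density)"
proof -
  interpret product_sigma_finite "\<lambda>_. density lborel std_normal_density"
    by (rule product_sigma_finite.intro) (simp add: prob_space_normal_density prob_space_imp_sigma_finite)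
  show ?thesis unfolding std_gaussian_def
    using assms by (intro product_nn_integral_prod) auto
qed

text \<open>The squares are linearized by \<open>exp (l * x\<^sup>2) = \<integral> exp (sqrt (2 * l) * x * g)\<close> over a standard
  normal \<open>g\<close>, after which Tonelli applies.\<close>
lemma nn_integral_exp_columns_le:
  fixes w :: "'d::finite \<Rightarrow> real" and J :: "'n set"
  assumes J: "finite J" and l: "0 \<le> l" "l < 1/2" and w: "(\<Sum>i\<in>UNIV. (w i)\<^sup>2) \<le> 1"
  shows "(\<integral>\<^sup>+y. (\<Prod>j\<in>J. ennreal (exp (l * (\<Sum>i\<in>UNIV. y (i, j) * w i)\<^sup>2))) \<partial>std_gaussian (UNIV \<times> J))
    \<le> ennreal ((1 / sqrt (1 - 2 * l)) ^ card J)"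
proof -
  interpret Y: prob_space "std_gaussian (UNIV \<times> J) :: ('d \<times> 'n \<Rightarrow> real) measure"
    by (rule prob_space_std_gaussian)
  interpret G: prob_space "std_gaussian J" by (rule prob_space_std_gaussian)
  interpret YG: pair_sigma_finite "std_gaussian (UNIV \<times> J) :: ('d \<times> 'n \<Rightarrow> real) measure" "std_gaussian J"
    by unfold_locales
  define c where "c = sqrt (2 * l)"
  have c2: "c\<^sup>2 = 2 * l" using l by (simp add: c_def)
  let ?h = "\<lambda>y g. \<Prod>j\<in>J. ennreal (exp (c * (\<Sum>i\<in>UNIV. y (i, j) * w i) * g j))"
  have [measurable]: "(\<lambda>(y, g). ?h y g) \<in> borel_measurable (std_gaussian (UNIV \<times> J) \<Otimes>\<^sub>M std_gaussian J)"
    by measurable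
  have "(\<integral>\<^sup>+y. (\<Prod>j\<in>J. ennreal (exp (l * (\<Sum>i\<in>UNIV. y (i, j) * w i)\<^sup>2))) \<partial>std_gaussian (UNIV \<times> J))
      = (\<integral>\<^sup>+y. \<integral>\<^sup>+g. ?h y g \<partial>std_gaussian J \<partial>std_gaussian (UNIV \<times> J))"
    by (intro nn_integral_cong, subst nn_integral_std_gaussian_prod[OF J])
      (auto simp: nn_integral_exp_normal[of 1, simplified] power_mult_distrib c2)
  also have "\<dots> = (\<integral>\<^sup>+g. \<integral>\<^sup>+y. ?h y g \<partial>std_gaussian (UNIV \<times> J) \<partial>std_gaussian J)"
    by (rule YG.Fubini'[symmetric]) measurable
  also have "\<dots> \<le> (\<integral>\<^sup>+g. (\<Prod>j\<in>J. ennreal (exp (l * (g j)\<^sup>2))) \<partial>std_gaussian J)"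
  proof (rule nn_integral_mono)
    fix g :: "'n \<Rightarrow> real"
    \<comment> \<open>For fixed \<open>g\<close> the exponent is linear in the entries of
      \<open>y\<close>, so the integral factors over all index pairs and each factor is a normal
      exponential moment.\<close>
    have "?h y g = (\<Prod>ij\<in>UNIV \<times> J. ennreal (exp ((c * g (snd ij) * w (fst ij)) * y ij)))" for y
    proof -
      have "?h y g = (\<Prod>j\<in>J. \<Prod>i\<in>UNIV. ennreal (exp ((c * g j * w i) * y (i, j))))"
        by (simp add: prod_ennreal sum_distrib_left sum_distrib_right mult_ac flip: exp_sum)
      also have "\<dots> = (\<Prod>i\<in>UNIV. \<Prod>j\<in>J. ennreal (exp ((c * g j * w i) * y (i, j))))"
        by (rule prod.swap)
      also have "\<dots> = (\<Prod>ij\<in>UNIV \<times> J. ennreal (exp ((c * g (snd ij) * w (fst ij)) * y ij)))"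
        by (simp add: prod.cartesian_product split_def)
      finally show ?thesis .
    qed
    then have "(\<integral>\<^sup>+y. ?h y g \<partial>std_gaussian (UNIV \<times> J))
        = (\<Prod>ij\<in>UNIV \<times> J. ennreal (exp ((c * g (snd ij) * w (fst ij))\<^sup>2 / 2)))"
      using J by (simp, subst nn_integral_std_gaussian_prod)
        (auto simp: nn_integral_exp_normal[of 1, simplified])
    also have "\<dots> = (\<Prod>ij\<in>UNIV \<times> J. ennreal (exp (l * (g (snd ij))\<^sup>2 * (w (fst ij))\<^sup>2)))"
      by (simp add: power_mult_distrib c2 mult.assoc)
    also have "\<dots> = (\<Prod>i\<in>UNIV. \<Prod>j\<in>J. ennreal (exp (l * (g j)\<^sup>2 * (w i)\<^sup>2)))"
      by (simp add: prod.cartesian_product split_def)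
    also have "\<dots> = (\<Prod>j\<in>J. \<Prod>i\<in>UNIV. ennreal (exp (l * (g j)\<^sup>2 * (w i)\<^sup>2)))"
      by (rule prod.swap)
    also have "\<dots> = (\<Prod>j\<in>J. ennreal (exp (l * (g j)\<^sup>2 * (\<Sum>i\<in>UNIV. (w i)\<^sup>2))))"
      by (simp add: prod_ennreal sum_distrib_left flip: exp_sum)
    also have "\<dots> \<le> (\<Prod>j\<in>J. ennreal (exp (l * (g j)\<^sup>2)))"
      using l w by (auto simp: prod_ennreal intro!: ennreal_leI prod_mono mult_left_le)
    finally show "(\<integral>\<^sup>+y. ?h y g \<partial>std_gaussian (UNIV \<times> J)) \<le> \<dots>" .
  qed
  also have "\<dots> = ennreal ((1 / sqrt (1 - 2 * l)) ^ card J)"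
    using l by (subst nn_integral_std_gaussian_prod[OF J])
      (auto simp: nn_integral_exp_square_std_normal ennreal_power)
  finally show ?thesis .
qed

text \<open>A Chernoff bound. The condition on \<open>w\<close> is \<le> 1 and not = 1 because
  \<open>w\<close> will be \<open>- sgn (A *v u)\<close>, which vanishes when \<open>A *v u\<close>
  does.\<close>

lemma emeasure_noise_tail_le:
  fixes w :: "'d::finite \<Rightarrow> real"
  assumes "0 < \<sigma>" "0 < \<gamma>" and w: "(\<Sum>i\<in>UNIV. (w i)\<^sup>2) \<le> 1"
  shows "emeasure (gaussian_noise_measure \<sigma>)
      {z \<in> space (gaussian_noise_measure \<sigma>). \<gamma> * \<sigma> \<le> (\<Sum>i\<in>UNIV. w i * z i)} \<le> ennreal (exp (- \<gamma>\<^sup>2 / 2))"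
proof -
  let ?Z = "gaussian_noise_measure \<sigma> :: ('d \<Rightarrow> real) measure"
  have [measurable_cong]: "sets ?Z = sets (\<Pi>\<^sub>M i\<in>UNIV. borel)"
    unfolding gaussian_noise_measure_def by (intro sets_PiM_cong) auto
  interpret product_sigma_finite "\<lambda>_::'d. density lborel (normal_density 0 \<sigma>)"
    by (rule product_sigma_finite.intro) (simp add: assms prob_space_normal_density prob_space_imp_sigma_finite)
  \<comment> \<open>For a unit vector \<open>w\<close>, this value minimizes the Chernoff bound
    \<open>exp (th\<^sup>2 * \<sigma>\<^sup>2 / 2 - th * \<gamma> * \<sigma>)\<close>.\<close>
  define th where "th = \<gamma> / \<sigma>"
  have th: "th > 0" using assms by (simp add: th_def)
  let ?f = "\<lambda>z::'d \<Rightarrow> real. \<Prod>i\<in>UNIV. ennreal (exp ((th * w i) * z i))"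
  have f: "?f z = ennreal (exp (th * (\<Sum>i\<in>UNIV. w i * z i)))" for z
    by (simp add: prod_ennreal sum_distrib_left mult.assoc flip: exp_sum)
  have "emeasure ?Z {z \<in> space ?Z. \<gamma> * \<sigma> \<le> (\<Sum>i\<in>UNIV. w i * z i)}
      = emeasure ?Z {z \<in> space ?Z. 1 \<le> ennreal (exp (- \<gamma>\<^sup>2)) * ?f z}"
  proof -
    have "\<gamma> * \<sigma> \<le> x \<longleftrightarrow> 1 \<le> ennreal (exp (- \<gamma>\<^sup>2)) * ennreal (exp (th * x))" for x
    proof -
      have "1 \<le> ennreal (exp (- \<gamma>\<^sup>2)) * ennreal (exp (th * x)) \<longleftrightarrow> \<gamma>\<^sup>2 \<le> th * x"
        by (simp flip: ennreal_mult exp_add)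
      also have "\<dots> \<longleftrightarrow> \<gamma> * \<sigma> \<le> x"
        using assms by (simp add: th_def field_simps power2_eq_square)
      finally show ?thesis by simp
    qed
    then show ?thesis by (simp only: f)
  qed
  also have "\<dots> \<le> ennreal (exp (- \<gamma>\<^sup>2)) * (\<integral>\<^sup>+z. ?f z * indicator (space ?Z) z \<partial>?Z)"
    using nn_integral_Markov_inequality[of ?f "space ?Z" ?Z "ennreal (exp (- \<gamma>\<^sup>2))"] by simp
  also have "(\<integral>\<^sup>+z. ?f z * indicator (space ?Z) z \<partial>?Z) = (\<integral>\<^sup>+z. ?f z \<partial>?Z)"
    by (intro nn_integral_cong) simp
  also have "\<dots> = (\<Prod>i\<in>UNIV. ennreal (exp ((th * w i)\<^sup>2 * \<sigma>\<^sup>2 / 2)))"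
    unfolding gaussian_noise_measure_def using assms
    by (subst product_nn_integral_prod) (auto simp: nn_integral_exp_normal)
  also have "\<dots> = ennreal (exp (\<gamma>\<^sup>2 / 2 * (\<Sum>i\<in>UNIV. (w i)\<^sup>2)))"
    using assms by (simp add: prod_ennreal th_def sum_distrib_left power_mult_distrib power_divide flip: exp_sum)
  also have "\<dots> \<le> ennreal (exp (\<gamma>\<^sup>2 / 2))"
    using w by (intro ennreal_leI) (auto intro!: mult_left_le)
  finally show ?thesis
    by (simp add: mult_left_mono flip: ennreal_mult exp_add)
qed

section \<open>Rotation invariance of the standard Gaussian measure\<close>

lemma borel_measurable_vec_lambda [measurable (raw)]:
  fixes f :: "'i::finite \<Rightarrow> 'a \<Rightarrow> 'b::euclidean_space"
  assumes "\<And>i. f i \<in> borel_measurable M"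
  shows "(\<lambda>x. \<chi> i. f i x) \<in> borel_measurable M"
proof (subst borel_measurable_euclidean_space, intro ballI)
  fix b :: "'b^'i" assume "b \<in> Basis"
  then obtain i u where "b = axis i u" by (auto simp: Basis_vec_def)
  then show "(\<lambda>x. (\<chi> i. f i x) \<bullet> b) \<in> borel_measurable M"
    using assms by (simp add: inner_axis)
qed

lemma borel_measurable_vec_nth [measurable]:
  "(\<lambda>x::'b::euclidean_space^'i::finite. x $ i) \<in> borel_measurable borel"
  by (intro borel_measurable_continuous_onI continuous_intros)

lemma power2_norm_vec: "(norm x)\<^sup>2 = (\<Sum>i\<in>UNIV. (x $ i)\<^sup>2)" for x :: "real^'i::finite"
  unfolding power2_norm_eq_inner inner_vec_def by (simp add: power2_eq_square)

text \<open>The uniqueness argument for Haar measure: \<open>A\<close> is weighed against the unit ball, which \<open>f\<close> preserves.\<close>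
lemma distr_lborel_orthogonal:
  fixes f :: "'a::euclidean_space \<Rightarrow> 'a"
  assumes f: "orthogonal_transformation f"
  shows "distr lborel borel f = lborel"
proof (rule measure_eqI)
  have lin: "linear f" by (rule orthogonal_transformation_linear[OF f])
  have [measurable]: "f \<in> borel_measurable borel"
    by (intro borel_measurable_continuous_onI linear_continuous_on)
      (simp add: lin linear_conv_bounded_linear[symmetric])
  have surj: "f (inv f y) = y" for y
    by (simp add: orthogonal_transformation_surj[OF f] surj_f_inv_f)
  have translate: "(\<integral>\<^sup>+x. h (c + x) \<partial>lborel) = (\<integral>\<^sup>+x. h x \<partial>lborel)"
    if [measurable]: "h \<in> borel_measurable borel" for h :: "'a \<Rightarrow> ennreal" and c
    by (subst (2) lborel_distr_plus[of c, symmetric]) (simp add: nn_integral_distr)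
  fix A assume "A \<in> sets (distr lborel borel f)"
  then have [measurable]: "A \<in> sets borel" by simp
  define B where "B = ball (0::'a) 1"
  have [measurable]: "B \<in> sets borel" by (simp add: B_def)
  have B: "0 < emeasure lborel B" "emeasure lborel B < \<infinity>"
    unfolding B_def by (auto simp: emeasure_ball unit_ball_vol_pos intro: emeasure_lborel_ball_finite)
  have "emeasure (distr lborel borel f) A = (\<integral>\<^sup>+x. indicator A (f x) \<partial>lborel)"
    using nn_integral_distr[of f lborel borel "indicator A"] by simp
  then have "emeasure (distr lborel borel f) A * emeasure lborel B
      = (\<integral>\<^sup>+x. indicator A (f x) * (\<integral>\<^sup>+y. indicator B y \<partial>lborel) \<partial>lborel)"
    by (simp add: nn_integral_multc)
  \<comment> \<open>The inner integral is translated by \<open>- f x\<close>, so that after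
    exchanging the integrals the roles of \<open>A\<close> and \<open>B\<close> can be
    swapped.\<close>
  also have "\<dots> = (\<integral>\<^sup>+x. indicator A (f x) * (\<integral>\<^sup>+y. indicator B (- f x + y) \<partial>lborel) \<partial>lborel)"
    by (subst translate) auto
  also have "\<dots> = (\<integral>\<^sup>+x. \<integral>\<^sup>+y. indicator A (f x) * indicator B (- f x + y) \<partial>lborel \<partial>lborel)"
    by (simp add: nn_integral_cmult)
  also have "\<dots> = (\<integral>\<^sup>+y. \<integral>\<^sup>+x. indicator A (f x) * indicator B (- f x + y) \<partial>lborel \<partial>lborel)"
    by (rule lborel_pair.Fubini'[symmetric]) measurable
  \<comment> \<open>Translating \<open>x\<close> by a preimage of \<open>y\<close> under
    \<open>f\<close> replaces \<open>f x\<close> by \<open>y + f x\<close>, which removes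
    \<open>y\<close> from the argument of \<open>B\<close>.\<close>
  also have "\<dots> = (\<integral>\<^sup>+y. \<integral>\<^sup>+x. indicator A (y + f x) * indicator B (- f x) \<partial>lborel \<partial>lborel)"
  proof (rule nn_integral_cong)
    fix y :: 'a
    show "(\<integral>\<^sup>+x. indicator A (f x) * indicator B (- f x + y) \<partial>lborel)
        = (\<integral>\<^sup>+x. indicator A (y + f x) * indicator B (- f x) \<partial>lborel)"
      by (subst translate[of _ "inv f y", symmetric]) (simp_all add: linear_add[OF lin] surj)
  qed
  also have "\<dots> = (\<integral>\<^sup>+x. \<integral>\<^sup>+y. indicator A (f x + y) * indicator B (- f x) \<partial>lborel \<partial>lborel)"
    by (subst lborel_pair.Fubini') (simp_all add: add.commute)
  also have "\<dots> = (\<integral>\<^sup>+x. emeasure lborel A * indicator B x \<partial>lborel)"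
  proof (rule nn_integral_cong)
    fix x :: 'a
    have "(\<integral>\<^sup>+y. indicator A (f x + y) \<partial>lborel) = emeasure lborel A"
      by (subst translate) auto
    moreover have "indicator B (- f x) = (indicator B x :: ennreal)"
      by (simp add: B_def indicator_def orthogonal_transformation_norm[OF f])
    ultimately show "(\<integral>\<^sup>+y. indicator A (f x + y) * indicator B (- f x) \<partial>lborel)
        = emeasure lborel A * indicator B x"
      by (simp add: nn_integral_multc)
  qed
  also have "\<dots> = emeasure lborel A * emeasure lborel B"
    by (simp add: nn_integral_cmult)
  finally show "emeasure (distr lborel borel f) A = emeasure lborel A"
    using B by (auto simp: mult.commute[of _ "emeasure lborel B"] ennreal_mult_cancel_left)
qed simp

text \<open>Rotations act on \<open>real^'i\<close>, whereas the random families are functions on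
  the index type. This passes between the two; it is enough to compare both measures on boxes, where
  each factors over the coordinates.\<close>

lemma std_gaussian_eq_distr_density:
  "std_gaussian UNIV = distr (density lborel (\<lambda>x::real^'i::finite. \<Prod>i\<in>UNIV. ennreal (std_normal_density (x $ i))))
    (\<Pi>\<^sub>M i\<in>UNIV. borel) (\<lambda>x i. x $ i)" (is "_ = distr ?D _ _")
proof -
  interpret product_sigma_finite "\<lambda>_::'i. density lborel std_normal_density"
    by (rule product_sigma_finite.intro) (simp add: prob_space_normal_density prob_space_imp_sigma_finite)
  have [measurable]: "(\<lambda>x i. x $ i) \<in> measurable borel (\<Pi>\<^sub>M i\<in>(UNIV::'i set). (borel :: real measure))"
    by (rule measurable_PiM_single') auto
  show ?thesis unfolding std_gaussian_def
  proof (rule PiM_eqI[symmetric])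
    show "sets (distr ?D (\<Pi>\<^sub>M i\<in>UNIV. borel) (\<lambda>x i. x $ i)) = sets (\<Pi>\<^sub>M i\<in>UNIV. density lborel (\<lambda>x. ennreal (std_normal_density x)))"
      by (simp, intro sets_PiM_cong) auto
    fix A :: "'i \<Rightarrow> real set" assume A: "\<And>i. i \<in> UNIV \<Longrightarrow> A i \<in> sets (density lborel (\<lambda>x. ennreal (std_normal_density x)))"
    then have [measurable]: "A i \<in> sets borel" for i by simp
    have boxA: "Pi\<^sub>E UNIV A \<in> sets (\<Pi>\<^sub>M i\<in>UNIV. borel)" by (intro sets_PiM_I_finite) auto
    \<comment> \<open>The product formula for \<open>lborel\<close> runs over \<open>Basis\<close>;
      \<open>idx\<close> recovers the coordinate from a basis vector, so that the right set
      \<open>A i\<close> can be attached to it.\<close>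
    define idx where "idx b = (THE i. b = axis i (1::real))" for b :: "real^'i"
    have idx [simp]: "idx (axis i 1) = i" for i by (auto simp: idx_def axis_eq_axis)
    have Basis: "Basis = range (\<lambda>i::'i. axis i (1::real))" by (auto simp: Basis_vec_def)
    have inj: "inj (\<lambda>i::'i. axis i (1::real))" by (auto simp: inj_on_def axis_eq_axis)
    let ?g = "\<lambda>i x. std_normal_density x * indicator (A i) x"
    have "emeasure (distr ?D (\<Pi>\<^sub>M i\<in>UNIV. borel) (\<lambda>x i. x $ i)) (Pi\<^sub>E UNIV A)
        = emeasure ?D {x. \<forall>i. x $ i \<in> A i}"
      using boxA by (simp add: emeasure_distr PiE_UNIV_domain)
        (auto simp: Pi_iff intro!: arg_cong[where f="emeasure ?D"])
    also have "\<dots> = (\<integral>\<^sup>+x. (\<Prod>i\<in>UNIV. ennreal (?g i (x $ i))) \<partial>lborel)"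
    proof (subst emeasure_density)
      show "(\<integral>\<^sup>+x. (\<Prod>i\<in>UNIV. ennreal (std_normal_density (x $ i))) * indicator {x. \<forall>i. x $ i \<in> A i} x \<partial>lborel)
         = (\<integral>\<^sup>+x. (\<Prod>i\<in>UNIV. ennreal (?g i (x $ i))) \<partial>lborel)"
      proof (intro nn_integral_cong)
        fix x :: "real^'i"
        show "(\<Prod>i\<in>UNIV. ennreal (std_normal_density (x $ i))) * indicator {x. \<forall>i. x $ i \<in> A i} x = (\<Prod>i\<in>UNIV. ennreal (?g i (x $ i)))"
        proof (cases "\<forall>i. x $ i \<in> A i")
          case False
          then obtain i where "x $ i \<notin> A i" by auto
          then have "(\<Prod>i\<in>UNIV. ennreal (?g i (x $ i))) = 0"
            by (intro prod_zero) (auto intro!: exI[of _ i])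
          with False show ?thesis by auto
        qed auto
      qed
    qed measurable
    also have "\<dots> = (\<integral>\<^sup>+x. ennreal (\<Prod>b\<in>Basis. ?g (idx b) (x \<bullet> b)) \<partial>lborel)"
      by (simp add: Basis prod.reindex[OF inj] inner_axis prod_ennreal)
    also have "\<dots> = (\<Prod>b\<in>Basis. \<integral>\<^sup>+x. ennreal (?g (idx b) x) \<partial>lborel)"
      by (subst prod_ennreal[symmetric], simp, subst nn_integral_lborel_prod[symmetric]) (auto simp: prod_ennreal)
    also have "\<dots> = (\<Prod>i\<in>UNIV. \<integral>\<^sup>+x. ennreal (?g i x) \<partial>lborel)"
      by (simp add: Basis prod.reindex[OF inj])
    also have "\<dots> = (\<Prod>i\<in>UNIV. emeasure (density lborel (\<lambda>x. ennreal (std_normal_density x))) (A i))"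
      by (intro prod.cong refl) (auto simp: emeasure_density ennreal_mult'' ennreal_indicator)
    finally show "emeasure (distr ?D (\<Pi>\<^sub>M i\<in>UNIV. borel) (\<lambda>x i. x $ i)) (Pi\<^sub>E UNIV A) = \<dots>" .
  qed simp
qed

text \<open>The density depends on the norm only, so it equals its own composition with
  \<open>f\<close>; it can then be pulled through the image measure, and \<open>f\<close> preserves
  \<open>lborel\<close>.\<close>

lemma distr_std_gaussian_orthogonal:
  fixes f :: "real^'i::finite \<Rightarrow> real^'i"
  assumes f: "orthogonal_transformation f"
  shows "distr (std_gaussian UNIV) (\<Pi>\<^sub>M i\<in>UNIV. borel) (\<lambda>x i. f (\<chi> i. x i) $ i) = std_gaussian UNIV"
proof -
  let ?d = "\<lambda>x::real^'i. \<Prod>i\<in>UNIV. ennreal (std_normal_density (x $ i))"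
  have [measurable]: "f \<in> borel_measurable borel"
    by (intro borel_measurable_continuous_onI linear_continuous_on)
      (simp add: f linear_conv_bounded_linear[symmetric] orthogonal_transformation_linear)
  have [measurable]: "(\<lambda>x i. x $ i) \<in> measurable borel (\<Pi>\<^sub>M i\<in>(UNIV::'i set). (borel :: real measure))"
    by (rule measurable_PiM_single') auto
  have "?d x = ennreal ((1 / sqrt (2 * pi)) ^ CARD('i) * exp (- (norm x)\<^sup>2 / 2))" for x
    by (simp add: power2_norm_vec prod_ennreal std_normal_density_def prod_dividef sum_negf
        sum_divide_distrib power_divide flip: exp_sum)
  then have inv: "?d (f x) = ?d x" for x
    by (simp add: orthogonal_transformation_norm[OF f])
  have "distr (density lborel ?d) borel f = distr (density lborel (\<lambda>x. ?d (f x))) borel f"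
    by (simp only: inv)
  also have "\<dots> = density (distr lborel borel f) ?d"
    by (rule density_distr[symmetric]) measurable
  finally have *: "distr (density lborel ?d) borel f = density lborel ?d"
    by (simp only: distr_lborel_orthogonal[OF f])
  have "distr (std_gaussian UNIV) (\<Pi>\<^sub>M i\<in>UNIV. borel) (\<lambda>x i. f (\<chi> i. x i) $ i)
      = distr (density lborel ?d) (\<Pi>\<^sub>M i\<in>UNIV. borel) (\<lambda>x i. f x $ i)"
    by (simp add: std_gaussian_eq_distr_density distr_distr comp_def)
  also have "\<dots> = distr (distr (density lborel ?d) borel f) (\<Pi>\<^sub>M i\<in>UNIV. borel) (\<lambda>x i. x $ i)"
    by (simp add: distr_distr comp_def)
  finally show ?thesis
    by (simp only: * std_gaussian_eq_distr_density)
qed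

section \<open>Joint exponential moment of the two chi-square variables\<close>

text \<open>Given the column \<open>a = A *v axis k 1\<close>, the components of \<open>sgn a v* A\<close> other than the \<open>k\<close>-th are
  standard normal. The \<open>k\<close>-th is \<open>norm a\<close>, hence the difference of squares.\<close>
lemma nn_integral_exp_axis_le:
  fixes k :: "'n::finite"
  assumes l: "0 \<le> l" "l < 1/2" and s: "s < 1/2"
  shows "(\<integral>\<^sup>+A. ennreal (exp (s * (norm (to_mat A *v axis k 1))\<^sup>2 +
      l * ((norm (sgn (to_mat A *v axis k 1) v* to_mat A))\<^sup>2 - (norm (to_mat A *v axis k 1))\<^sup>2)))
      \<partial>(std_gaussian UNIV :: ('d::finite \<times> 'n \<Rightarrow> real) measure))
    \<le> ennreal ((1 / sqrt (1 - 2 * s)) ^ CARD('d) * (1 / sqrt (1 - 2 * l)) ^ CARD('n))" (is "?L \<le> _")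
proof -
  let ?J = "UNIV - {k}"
  let ?I0 = "(UNIV::'d set) \<times> {k}" and ?I1 = "(UNIV::'d set) \<times> ?J"
  interpret product_sigma_finite "\<lambda>_::'d \<times> 'n. density lborel std_normal_density"
    by (rule product_sigma_finite.intro) (simp add: prob_space_normal_density prob_space_imp_sigma_finite)
  define w where "w A i = sgn (\<chi> i. A (i, k)) $ i" for A :: "'d \<times> 'n \<Rightarrow> real" and i
  define g where "g A = (\<Prod>i\<in>UNIV. ennreal (exp (s * (A (i, k))\<^sup>2)))" for A :: "'d \<times> 'n \<Rightarrow> real"
  define h where "h w A = (\<Prod>j\<in>?J. ennreal (exp (l * (\<Sum>i\<in>UNIV. A (i, j) * w i)\<^sup>2)))"
    for w and A :: "'d \<times> 'n \<Rightarrow> real"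
  have col: "to_mat A *v axis k 1 = (\<chi> i. A (i, k))" for A :: "'d \<times> 'n \<Rightarrow> real"
    by (simp add: matrix_vector_mult_basis column_def to_mat_def)
  have sq: "(\<Sum>i\<in>UNIV. (w A i)\<^sup>2) \<le> 1" for A
    using power2_norm_vec[of "sgn (\<chi> i. A (i, k))"] by (simp add: w_def norm_sgn split: if_splits)
  have eq: "ennreal (exp (s * (norm (to_mat A *v axis k 1))\<^sup>2 +
      l * ((norm (sgn (to_mat A *v axis k 1) v* to_mat A))\<^sup>2 - (norm (to_mat A *v axis k 1))\<^sup>2)))
      = g A * h (w A) A" for A :: "'d \<times> 'n \<Rightarrow> real"
  proof -
    define a :: "real^'d" where "a = (\<chi> i. A (i, k))"
    have "(norm (sgn a v* to_mat A))\<^sup>2 = (\<Sum>j\<in>UNIV. (\<Sum>i\<in>UNIV. A (i, j) * w A i)\<^sup>2)"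
      by (simp add: power2_norm_vec vector_matrix_mult_def to_mat_def w_def a_def mult.commute)
    also have "\<dots> = (\<Sum>i\<in>UNIV. A (i, k) * w A i)\<^sup>2 + (\<Sum>j\<in>?J. (\<Sum>i\<in>UNIV. A (i, j) * w A i)\<^sup>2)"
      by (rule sum.remove) auto
    also have "(\<Sum>i\<in>UNIV. A (i, k) * w A i) = a \<bullet> sgn a"
      by (simp add: inner_vec_def a_def w_def)
    also have "a \<bullet> sgn a = norm a"
      by (cases "a = 0") (simp_all add: sgn_div_norm power2_eq_square flip: power2_norm_eq_inner)
    finally have *: "(norm (sgn a v* to_mat A))\<^sup>2 - (norm a)\<^sup>2 = (\<Sum>j\<in>?J. (\<Sum>i\<in>UNIV. A (i, j) * w A i)\<^sup>2)"
      by simp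
    have "(norm a)\<^sup>2 = (\<Sum>i\<in>UNIV. (A (i, k))\<^sup>2)" by (simp add: power2_norm_vec a_def)
    then show ?thesis
      unfolding col a_def[symmetric] * g_def h_def
      by (simp add: prod_ennreal exp_add ennreal_mult sum_distrib_left flip: exp_sum)
  qed
  have [measurable]: "(\<lambda>A. w A i) \<in> borel_measurable (\<Pi>\<^sub>M ij\<in>UNIV. borel)" for i
    unfolding w_def sgn_div_norm by measurable
  have meas: "(\<lambda>A. g A * h (w A) A) \<in> borel_measurable (\<Pi>\<^sub>M ij\<in>UNIV. borel)"
    unfolding g_def h_def by measurable
  have UN: "?I0 \<union> ?I1 = UNIV" by auto
  \<comment> \<open>The measure is split into column \<open>k\<close> and the rest. Both
    \<open>g\<close> and \<open>w\<close> depend on column \<open>k\<close> only, while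
    \<open>h\<close> with its first argument fixed sees the other columns only, so in the inner
    integral the direction \<open>w x\<close> is a constant.\<close>
  have "?L = integral\<^sup>N (\<Pi>\<^sub>M ij\<in>?I0 \<union> ?I1. density lborel std_normal_density) (\<lambda>A. g A * h (w A) A)"
    unfolding UN eq std_gaussian_def ..
  also have "\<dots> = (\<integral>\<^sup>+x. \<integral>\<^sup>+y. g (merge ?I0 ?I1 (x, y)) * h (w (merge ?I0 ?I1 (x, y))) (merge ?I0 ?I1 (x, y))
      \<partial>std_gaussian ?I1 \<partial>std_gaussian ?I0)"
    unfolding std_gaussian_def
  proof (rule product_nn_integral_fold)
    show "(\<lambda>A. g A * h (w A) A) \<in> borel_measurable (\<Pi>\<^sub>M ij\<in>?I0 \<union> ?I1. density lborel std_normal_density)"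
      unfolding UN using meas by (simp cong: measurable_cong_sets sets_PiM_cong)
  qed auto
  also have "\<dots> = (\<integral>\<^sup>+x. g x * (\<integral>\<^sup>+y. h (w x) y \<partial>std_gaussian ?I1) \<partial>std_gaussian ?I0)"
  proof (rule nn_integral_cong)
    fix x :: "'d \<times> 'n \<Rightarrow> real"
    have "g (merge ?I0 ?I1 (x, y)) = g x" "w (merge ?I0 ?I1 (x, y)) = w x"
        "h u (merge ?I0 ?I1 (x, y)) = h u y" for y u
      by (simp_all add: g_def w_def h_def merge_def fun_eq_iff)
    then show "(\<integral>\<^sup>+y. g (merge ?I0 ?I1 (x, y)) * h (w (merge ?I0 ?I1 (x, y))) (merge ?I0 ?I1 (x, y)) \<partial>std_gaussian ?I1)
        = g x * (\<integral>\<^sup>+y. h (w x) y \<partial>std_gaussian ?I1)"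
      by (simp, intro nn_integral_cmult) (simp add: h_def)
  qed
  also have "\<dots> \<le> (\<integral>\<^sup>+x. g x * ennreal ((1 / sqrt (1 - 2 * l)) ^ card ?J) \<partial>std_gaussian ?I0)"
    unfolding h_def using l sq by (intro nn_integral_mono mult_left_mono nn_integral_exp_columns_le) auto
  also have "\<dots> = (\<integral>\<^sup>+x. (\<Prod>ij\<in>?I0. ennreal (exp (s * (x ij)\<^sup>2))) \<partial>std_gaussian ?I0)
      * ennreal ((1 / sqrt (1 - 2 * l)) ^ card ?J)"
  proof -
    have "g x = (\<Prod>ij\<in>?I0. ennreal (exp (s * (x ij)\<^sup>2)))" for x
    proof -
      have "?I0 = (\<lambda>i. (i, k)) ` UNIV" by auto
      then show ?thesis by (simp add: g_def prod.reindex inj_on_def)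
    qed
    then show ?thesis by (simp add: nn_integral_multc)
  qed
  also have "\<dots> = ennreal ((1 / sqrt (1 - 2 * s)) ^ CARD('d) * (1 / sqrt (1 - 2 * l)) ^ card ?J)"
    using s l by (subst nn_integral_std_gaussian_prod)
      (simp_all add: nn_integral_exp_square_std_normal ennreal_power ennreal_mult card_cartesian_product)
  \<comment> \<open>Since \<open>0 \<le> l\<close>, the base is at least 1, so counting column
    \<open>k\<close> as well only weakens the bound.\<close>
  also have "\<dots> \<le> ennreal ((1 / sqrt (1 - 2 * s)) ^ CARD('d) * (1 / sqrt (1 - 2 * l)) ^ CARD('n))"
    using s l by (intro ennreal_leI mult_left_mono power_increasing card_mono) auto
  finally show ?thesis .
qed

text \<open>The squared norm of the family of all entries is the sum of the squared norms of the
  rows, and \<open>f\<close> preserves each of these.\<close>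

lemma orthogonal_transformation_rows:
  fixes f :: "real^'n::finite \<Rightarrow> real^'n"
  assumes f: "orthogonal_transformation f"
  shows "orthogonal_transformation (\<lambda>x::real^('d::finite \<times> 'n). \<chi> ij. f (\<chi> j. x $ (fst ij, j)) $ snd ij)"
    (is "orthogonal_transformation ?F")
  unfolding orthogonal_transformation
proof (intro conjI allI)
  have lin: "linear f" by (rule orthogonal_transformation_linear[OF f])
  show "linear ?F"
  proof (rule linearI)
    fix x y :: "real^('d \<times> 'n)" and c :: real
    have "(\<chi> j. (x + y) $ (i, j)) = (\<chi> j. x $ (i, j)) + (\<chi> j. y $ (i, j))"
      "(\<chi> j. (c *\<^sub>R x) $ (i, j)) = c *\<^sub>R (\<chi> j. x $ (i, j))" for i
      by (simp_all add: vec_eq_iff)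
    then have "?F (x + y) = (\<chi> ij. f ((\<chi> j. x $ (fst ij, j)) + (\<chi> j. y $ (fst ij, j))) $ snd ij)"
      "?F (c *\<^sub>R x) = (\<chi> ij. f (c *\<^sub>R (\<chi> j. x $ (fst ij, j))) $ snd ij)"
      by (simp_all only:)
    then show "?F (x + y) = ?F x + ?F y" "?F (c *\<^sub>R x) = c *\<^sub>R ?F x"
      by (simp_all only: linear_add[OF lin] linear_scale[OF lin]) (simp_all add: vec_eq_iff)
  qed
  have norm_rows: "(norm x)\<^sup>2 = (\<Sum>i\<in>UNIV. (norm (\<chi> j. x $ (i, j)))\<^sup>2)" for x :: "real^('d \<times> 'n)"
    by (simp add: power2_norm_vec sum.cartesian_product split_def UNIV_Times_UNIV[symmetric] del: UNIV_Times_UNIV)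
  fix x :: "real^('d \<times> 'n)"
  have "(norm (?F x))\<^sup>2 = (norm x)\<^sup>2"
    by (simp add: norm_rows orthogonal_transformation_norm[OF f])
  then show "norm (?F x) = norm x" by simp
qed

text \<open>Reduction to a coordinate vector: rotating every row by an \<open>f\<close> with
  \<open>f u = axis k 1\<close> preserves the law of the matrix. It carries \<open>A *v u\<close> to
  the product with \<open>axis k 1\<close>, as \<open>f\<close> preserves inner products, and sends
  \<open>w v* A\<close> to its image under \<open>f\<close>, which has the same norm.\<close>

lemma nn_integral_exp_unit_le:
  fixes u :: "real^'n::finite"
  assumes l: "0 \<le> l" "l < 1/2" and s: "s < 1/2" and u: "norm u = 1"
  shows "(\<integral>\<^sup>+A. ennreal (exp (s * (norm (to_mat A *v u))\<^sup>2 +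
      l * ((norm (sgn (to_mat A *v u) v* to_mat A))\<^sup>2 - (norm (to_mat A *v u))\<^sup>2)))
      \<partial>(std_gaussian UNIV :: ('d::finite \<times> 'n \<Rightarrow> real) measure))
    \<le> ennreal ((1 / sqrt (1 - 2 * s)) ^ CARD('d) * (1 / sqrt (1 - 2 * l)) ^ CARD('n))"
proof -
  let ?G = "std_gaussian UNIV :: ('d::finite \<times> 'n \<Rightarrow> real) measure"
  let ?X = "\<lambda>u A. ennreal (exp (s * (norm (to_mat A *v u))\<^sup>2 +
      l * ((norm (sgn (to_mat A *v u) v* to_mat A))\<^sup>2 - (norm (to_mat A *v u))\<^sup>2)))"
  \<comment> \<open>Any coordinate will do.\<close>
  define k :: 'n where "k = undefined"
  obtain f :: "real^'n \<Rightarrow> real^'n" where f: "orthogonal_transformation f" and fu: "f u = axis k 1"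
    using orthogonal_transformation_exists[of u "axis k 1"] u by (metis norm_axis_1)
  define F where "F = (\<lambda>x::real^('d \<times> 'n). \<chi> ij. f (\<chi> j. x $ (fst ij, j)) $ snd ij)"
  define R where "R A = (\<lambda>ij. F (\<chi> ij. A ij) $ ij)" for A
  have lin: "linear f" by (rule orthogonal_transformation_linear[OF f])
  have row: "to_mat (R A) $ i = f (to_mat A $ i)" for A i
    by (simp add: R_def F_def to_mat_def vec_eq_iff)
  have R: "?X (axis k 1) (R A) = ?X u A" for A
  proof -
    have 1: "to_mat (R A) *v axis k 1 = to_mat A *v u"
    proof (subst vec_eq_iff, intro allI)
      fix i
      have "(to_mat (R A) *v axis k 1) $ i = f (to_mat A $ i) \<bullet> f u"
        by (simp add: matrix_vector_mul_component row fu)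
      also have "\<dots> = (to_mat A *v u) $ i"
        using f by (simp add: orthogonal_transformation_def matrix_vector_mul_component)
      finally show "(to_mat (R A) *v axis k 1) $ i = (to_mat A *v u) $ i" .
    qed
    have vm: "w v* M = (\<Sum>i\<in>UNIV. w $ i *\<^sub>R M $ i)" for w :: "real^'d" and M :: "real^'n^'d"
      by (simp add: vec_eq_iff vector_matrix_mult_def mult.commute)
    have "w v* to_mat (R A) = f (w v* to_mat A)" for w
      by (simp add: vm row linear_sum[OF lin] linear_scale[OF lin])
    then have 2: "norm (w v* to_mat (R A)) = norm (w v* to_mat A)" for w
      by (simp add: orthogonal_transformation_norm[OF f])
    show ?thesis by (simp only: 1 2)
  qed
  have FO: "orthogonal_transformation F"
    unfolding F_def by (rule orthogonal_transformation_rows[OF f])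
  have [measurable]: "F \<in> borel_measurable borel"
    by (intro borel_measurable_continuous_onI linear_continuous_on)
      (simp add: FO orthogonal_transformation_linear linear_conv_bounded_linear[symmetric])
  have meas: "(\<lambda>A. ?X (axis k 1) A) \<in> borel_measurable (\<Pi>\<^sub>M ij\<in>UNIV. borel)"
    unfolding to_mat_def matrix_vector_mult_def vector_matrix_mult_def sgn_div_norm by measurable
  have [measurable]: "R \<in> measurable (\<Pi>\<^sub>M ij\<in>UNIV. borel) (\<Pi>\<^sub>M ij\<in>UNIV. borel)"
    unfolding R_def by (rule measurable_PiM_single') auto
  have "(\<integral>\<^sup>+A. ?X u A \<partial>?G) = (\<integral>\<^sup>+A. ?X (axis k 1) (R A) \<partial>?G)"
    by (simp only: R)
  also have "\<dots> = (\<integral>\<^sup>+A. ?X (axis k 1) A \<partial>distr ?G (\<Pi>\<^sub>M ij\<in>UNIV. borel) R)"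
  proof (rule nn_integral_distr[symmetric])
    show "R \<in> measurable ?G (\<Pi>\<^sub>M ij\<in>UNIV. borel)" by measurable
  qed (use meas in simp)
  also have "distr ?G (\<Pi>\<^sub>M ij\<in>UNIV. borel) R = ?G"
    unfolding R_def by (rule distr_std_gaussian_orthogonal[OF FO])
  also have "(\<integral>\<^sup>+A. ?X (axis k 1) A \<partial>?G) \<le> ennreal ((1 / sqrt (1 - 2 * s)) ^ CARD('d) * (1 / sqrt (1 - 2 * l)) ^ CARD('n))"
    by (rule nn_integral_exp_axis_le[OF l s])
  finally show ?thesis .
qed

section \<open>Deterministic analysis of the least-squares choice\<close>

text \<open>The three alternatives involve \<open>A\<close>, \<open>z\<close> and the direction of
  \<open>c - xh\<close>, but not \<open>x\<close>. Hence a union bound over finitely many pairs of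
  codewords controls all \<open>x\<close> in the set simultaneously.\<close>

lemma least_squares_error_cases:
  fixes A :: "real^'n::finite^'d::finite" and x c xh :: "real^'n" and z :: "real^'d"
  assumes le: "(norm (A *v x + z - A *v xh))\<^sup>2 \<le> (norm (A *v x + z - A *v c))\<^sup>2"
    and \<delta>: "norm (x - c) \<le> \<delta>"
    and far: "(2 * B * \<delta> + 2 * g) / sqrt p + \<delta> \<le> norm (x - xh)"
    and pos: "0 < B" "0 < g" "0 < p"
  defines "a \<equiv> A *v sgn (c - xh)"
  shows "c \<noteq> xh \<and> ((norm a)\<^sup>2 \<le> p \<or> g \<le> - sgn a \<bullet> z
    \<or> p \<le> (norm a)\<^sup>2 \<and> B\<^sup>2 * (norm a)\<^sup>2 \<le> p * (norm (sgn a v* A))\<^sup>2)"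
proof -
  define L where "L = norm (c - xh)"
  define h where "h = x - c"
  define N where "N = norm (sgn a v* A)"
  have \<delta>0: "0 \<le> \<delta>" using \<delta> norm_ge_zero order_trans by blast
  have "norm (x - xh) \<le> norm (x - c) + L"
    using norm_triangle_ineq[of "x - c" "c - xh"] by (simp add: L_def)
  then have L: "(2 * B * \<delta> + 2 * g) / sqrt p \<le> L" using far \<delta> by linarith
  moreover have "0 < (2 * B * \<delta> + 2 * g) / sqrt p"
    using pos \<delta>0 by (intro divide_pos_pos add_nonneg_pos) auto
  ultimately have L0: "0 < L" by linarith
  then have ne: "c \<noteq> xh" by (auto simp: L_def)
  have scale: "c - xh = L *\<^sub>R sgn (c - xh)" using ne by (simp add: L_def sgn_div_norm)
  have "A *v x + z - A *v xh = (A *v h + z) + A *v (c - xh)"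
    by (simp add: h_def matrix_vector_mult_diff_distrib)
  also have "A *v (c - xh) = L *\<^sub>R a"
    by (subst scale) (simp add: a_def matrix_vector_mult_scaleR)
  finally have 1: "A *v x + z - A *v xh = (A *v h + z) + L *\<^sub>R a" .
  have 2: "A *v x + z - A *v c = A *v h + z"
    by (simp add: h_def matrix_vector_mult_diff_distrib)
  \<comment> \<open>The difference of the two squared residuals; the common term, the squared norm
    of \<open>A *v h + z\<close>, cancels.\<close>
  have "L * (2 * ((A *v h + z) \<bullet> a) + L * (norm a)\<^sup>2) \<le> 0"
    using le unfolding 1 2 power2_norm_eq_inner
    by (simp add: inner_add_left inner_add_right inner_commute algebra_simps)
  then have quad: "L * (norm a)\<^sup>2 \<le> - 2 * ((A *v h + z) \<bullet> a)"
    using L0 by (simp add: mult_le_0_iff)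
  have "p \<le> (norm a)\<^sup>2 \<and> B\<^sup>2 * (norm a)\<^sup>2 \<le> p * N\<^sup>2"
    if large: "\<not> (norm a)\<^sup>2 \<le> p" and noise: "\<not> g \<le> - sgn a \<bullet> z"
  proof
    show "p \<le> (norm a)\<^sup>2" using large by simp
    have a0: "norm a > 0" using large pos by auto
    then have "a = norm a *\<^sub>R sgn a" by (simp add: sgn_div_norm)
    then have "(A *v h + z) \<bullet> a = norm a * ((A *v h + z) \<bullet> sgn a)" by (metis inner_scaleR_right)
    then have "norm a * (L * norm a) \<le> norm a * (- 2 * ((A *v h + z) \<bullet> sgn a))"
      using quad by (simp add: power2_eq_square algebra_simps)
    then have "L * norm a \<le> - 2 * ((A *v h + z) \<bullet> sgn a)"
      using a0 by (simp only: mult_le_cancel_left_pos)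
    also have "\<dots> = 2 * (- (h \<bullet> (sgn a v* A))) + 2 * (- sgn a \<bullet> z)"
    proof -
      have "(A *v h) \<bullet> sgn a = h \<bullet> (sgn a v* A)" by (metis dot_lmul_matrix inner_commute)
      then show ?thesis by (simp add: inner_add_left inner_commute[of "sgn a" z])
    qed
    also have "\<dots> < 2 * (\<delta> * N) + 2 * g"
    proof -
      have "- (h \<bullet> (sgn a v* A)) \<le> norm h * N"
        using Cauchy_Schwarz_ineq2[of h "sgn a v* A"] by (simp add: N_def)
      also have "\<dots> \<le> \<delta> * N" using \<delta> by (simp add: h_def N_def mult_right_mono)
      finally show ?thesis using noise by linarith
    qed
    finally have up: "L * norm a < 2 * \<delta> * N + 2 * g" by simp
    \<comment> \<open>As \<open>1 \<le> y\<close>, the noise term \<open>2 * g\<close> on the right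
      is absorbed by \<open>2 * g * y\<close> on the left, and only the terms with \<delta>
      remain.\<close>
    define y where "y = norm a / sqrt p"
    have y1: "1 \<le> y" using large pos a0 by (simp add: y_def real_le_rsqrt real_sqrt_le_iff real_le_lsqrt)
    have "(2 * B * \<delta> + 2 * g) * y = (2 * B * \<delta> + 2 * g) / sqrt p * norm a" by (simp add: y_def)
    also have "\<dots> \<le> L * norm a" using L by (intro mult_right_mono) auto
    finally have "2 * B * \<delta> * y + 2 * g * y < 2 * \<delta> * N + 2 * g" using up by (simp add: algebra_simps)
    moreover have "g \<le> g * y" using y1 pos by simp
    ultimately have "\<delta> * (B * y) < \<delta> * N" by (simp add: algebra_simps)
    \<comment> \<open>The preceding inequality is strict, which excludes \<delta> = 0 and permits
      the division by \<delta>.\<close>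
    then have "B * y \<le> N" using \<delta>0 by (simp add: mult_less_cancel_left)
    then have "(B * y)\<^sup>2 \<le> N\<^sup>2" using pos y1 by (intro power_mono) auto
    then show "B\<^sup>2 * (norm a)\<^sup>2 \<le> p * N\<^sup>2"
      using pos by (simp add: y_def power_mult_distrib power_divide field_simps)
  qed
  with ne show ?thesis unfolding N_def by blast
qed

section \<open>Chernoff bounds for the events that concern the matrix alone\<close>

lemma borel_measurable_to_mat_mult [measurable]:
  fixes u :: "real^'n::finite"
  shows "(\<lambda>A. to_mat A *v u :: real^'d::finite) \<in> borel_measurable (\<Pi>\<^sub>M ij\<in>UNIV. borel)"
  unfolding to_mat_def matrix_vector_mult_def by measurable

lemma borel_measurable_sgn_mult_to_mat:
  fixes u :: "real^'n::finite"
  shows "(\<lambda>A. (norm (sgn (to_mat A *v u :: real^'d::finite) v* to_mat A))\<^sup>2) \<in> borel_measurable (\<Pi>\<^sub>M ij\<in>UNIV. borel)"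
  unfolding to_mat_def matrix_vector_mult_def vector_matrix_mult_def sgn_div_norm by measurable

text \<open>Markov's inequality for the joint exponential moment. The parameter \<open>s\<close>
  weighs \<open>(norm a)\<^sup>2\<close> and \<open>l\<close> the independent remainder, where
  \<open>a\<close> is \<open>to_mat A *v u\<close>; with \<open>l = 0\<close> this is the usual
  bound for a single chi-square variable.\<close>

lemma emeasure_std_gaussian_chernoff:
  fixes u :: "real^'n::finite"
  assumes l: "0 \<le> l" "l < 1/2" and s: "s < 1/2" and u: "norm u = 1"
    and S: "S \<in> sets (std_gaussian UNIV :: ('d::finite \<times> 'n \<Rightarrow> real) measure)"
    and K: "\<And>A. A \<in> S \<Longrightarrow> K \<le> s * (norm (to_mat A *v u))\<^sup>2 +
      l * ((norm (sgn (to_mat A *v u) v* to_mat A))\<^sup>2 - (norm (to_mat A *v u))\<^sup>2)"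
  shows "emeasure (std_gaussian UNIV) S
    \<le> ennreal (exp (- K) * ((1 / sqrt (1 - 2 * s)) ^ CARD('d) * (1 / sqrt (1 - 2 * l)) ^ CARD('n)))"
proof -
  let ?G = "std_gaussian UNIV :: ('d::finite \<times> 'n \<Rightarrow> real) measure"
  let ?e = "\<lambda>A. s * (norm (to_mat A *v u))\<^sup>2 +
      l * ((norm (sgn (to_mat A *v u) v* to_mat A))\<^sup>2 - (norm (to_mat A *v u))\<^sup>2)"
  have "emeasure ?G S = (\<integral>\<^sup>+A. indicator S A \<partial>?G)" using S by simp
  also have "\<dots> \<le> (\<integral>\<^sup>+A. ennreal (exp (- K)) * ennreal (exp (?e A)) \<partial>?G)"
    using K by (intro nn_integral_mono) (auto simp: indicator_def simp flip: ennreal_mult exp_add)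
  also have "\<dots> = ennreal (exp (- K)) * (\<integral>\<^sup>+A. ennreal (exp (?e A)) \<partial>?G)"
  proof (rule nn_integral_cmult)
    define N where "N A = (norm (sgn (to_mat A *v u :: real^'d) v* to_mat A))\<^sup>2" for A
    have [measurable]: "N \<in> borel_measurable (\<Pi>\<^sub>M ij\<in>UNIV. borel)"
      unfolding N_def by (rule borel_measurable_sgn_mult_to_mat)
    show "(\<lambda>A. ennreal (exp (?e A))) \<in> borel_measurable ?G"
      unfolding N_def[symmetric] by measurable
  qed
  also have "\<dots> \<le> ennreal (exp (- K)) *
      ennreal ((1 / sqrt (1 - 2 * s)) ^ CARD('d) * (1 / sqrt (1 - 2 * l)) ^ CARD('n))"
    by (intro mult_left_mono nn_integral_exp_unit_le l s u) simp
  finally show ?thesis using l s by (simp flip: ennreal_mult)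
qed

lemma power_inverse_sqrt_eq_exp:
  assumes "0 < x"
  shows "(1 / sqrt x) ^ k = exp (- real k / 2 * ln x)"
proof -
  have "1 / sqrt x = exp (- ln x / 2)"
    using assms by (simp add: exp_minus ln_sqrt[symmetric] field_simps)
  then show ?thesis by (simp flip: exp_of_nat_mult)
qed

lemma emeasure_std_gaussian_small_image_le:
  fixes u :: "real^'n::finite" and \<tau> :: real
  assumes \<tau>: "0 < \<tau>" "\<tau> < 1" and u: "norm u = 1"
  defines "S \<equiv> {A \<in> space (std_gaussian UNIV :: ('d::finite \<times> 'n \<Rightarrow> real) measure).
    (norm (to_mat A *v u))\<^sup>2 \<le> (1 - \<tau>) * CARD('d)}"
  shows "S \<in> sets (std_gaussian UNIV)"
    and "emeasure (std_gaussian UNIV) S \<le> ennreal (exp (CARD('d) / 2 * (\<tau> + ln (1 - \<tau>))))"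
proof -
  let ?G = "std_gaussian UNIV :: ('d \<times> 'n \<Rightarrow> real) measure"
  let ?d = "real CARD('d)"
  \<comment> \<open>The minimizer of
    \<open>exp (- s * (1 - \<tau>) * d) * (1 - 2 * s) powr (- d / 2)\<close>, characterized by
    \<open>1 - 2 * s = 1 / (1 - \<tau>)\<close>.\<close>
  define s where "s = - \<tau> / (2 * (1 - \<tau>))"
  have s: "s < 0" "1 - 2 * s = 1 / (1 - \<tau>)" using \<tau> by (auto simp: s_def field_simps)
  show S: "S \<in> sets ?G" unfolding S_def by measurable
  have "emeasure ?G S \<le> ennreal (exp (- (- \<tau> * ?d / 2)) *
      ((1 / sqrt (1 - 2 * s)) ^ CARD('d) * (1 / sqrt (1 - 2 * 0)) ^ CARD('n)))"
  proof (rule emeasure_std_gaussian_chernoff[OF _ _ _ u S])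
    fix A assume "A \<in> S"
    then have "s * ((1 - \<tau>) * ?d) \<le> s * (norm (to_mat A *v u))\<^sup>2"
      using s by (intro mult_left_mono_neg) (auto simp: S_def)
    moreover have "s * (1 - \<tau>) = - \<tau> / 2" using \<tau> by (simp add: s_def field_simps)
    then have "s * ((1 - \<tau>) * ?d) = - \<tau> * ?d / 2" by (simp add: mult.assoc[symmetric])
    ultimately show "- \<tau> * ?d / 2 \<le> s * (norm (to_mat A *v u))\<^sup>2 +
      0 * ((norm (sgn (to_mat A *v u) v* to_mat A))\<^sup>2 - (norm (to_mat A *v u))\<^sup>2)" by simp
  qed (use s in auto)
  also have "(1 / sqrt (1 - 2 * s)) ^ CARD('d) = exp (?d / 2 * ln (1 - \<tau>))"
    unfolding s using \<tau> by (simp add: power_inverse_sqrt_eq_exp ln_div)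
  also have "exp (- (- \<tau> * ?d / 2)) * (exp (?d / 2 * ln (1 - \<tau>)) * (1 / sqrt (1 - 2 * 0)) ^ CARD('n))
      = exp (?d / 2 * (\<tau> + ln (1 - \<tau>)))"
    by (simp add: algebra_simps add_divide_distrib flip: exp_add)
  finally show "emeasure ?G S \<le> ennreal (exp (?d / 2 * (\<tau> + ln (1 - \<tau>))))" .
qed

text \<open>The Chernoff parameter \<open>s\<close> is the optimal one of the preceding lemma, and \<open>l\<close> is optimal for the
  event that a chi-square variable with \<open>CARD('n)\<close> degrees of freedom exceeds \<open>W\<close>. This makes the bound
  a multiple of the preceding one.\<close>
lemma emeasure_std_gaussian_unbalanced_le:
  fixes u :: "real^'n::finite" and \<tau> t :: real
  assumes \<tau>: "0 < \<tau>" "\<tau> < 1" and t: "0 < t" and u: "norm u = 1"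
  defines "B \<equiv> sqrt CARD('n) + (t + 1) * sqrt CARD('d)"
  defines "S \<equiv> {A \<in> space (std_gaussian UNIV :: ('d::finite \<times> 'n \<Rightarrow> real) measure).
    (1 - \<tau>) * CARD('d) \<le> (norm (to_mat A *v u))\<^sup>2 \<and>
    B\<^sup>2 * (norm (to_mat A *v u))\<^sup>2
      \<le> (1 - \<tau>) * CARD('d) * (norm (sgn (to_mat A *v u) v* to_mat A))\<^sup>2}"
  shows "S \<in> sets (std_gaussian UNIV)"
    and "emeasure (std_gaussian UNIV) S
      \<le> ennreal (exp (CARD('d) / 2 * (\<tau> + ln (1 - \<tau>))) * exp (- real CARD('d) * t\<^sup>2 / 2))"
proof -
  let ?G = "std_gaussian UNIV :: ('d \<times> 'n \<Rightarrow> real) measure"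
  let ?d = "real CARD('d)" and ?n = "real CARD('n)"
  have d: "1 \<le> ?d" and n: "1 \<le> ?n" by (simp_all add: Suc_le_eq)
  define p where "p = (1 - \<tau>) * ?d"
  have p: "0 < p" "p < ?d" using \<tau> d by (auto simp: p_def)
  \<comment> \<open>On \<open>S\<close> the remainder \<open>N A - a\<close>, with \<open>a\<close>
    the squared norm of \<open>to_mat A *v u\<close>, is at least \<open>W / p * a\<close>, hence at
    least \<open>W\<close> because \<open>p \<le> a\<close>.\<close>
  define W where "W = B\<^sup>2 - p"
  have B: "B\<^sup>2 = (sqrt ?n + t * sqrt ?d)\<^sup>2 + ?d + 2 * sqrt ?d * (sqrt ?n + t * sqrt ?d)"
    by (simp add: B_def power2_eq_square algebra_simps)
  have X: "0 \<le> 2 * sqrt ?d * (sqrt ?n + t * sqrt ?d)" using t by simp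
  then have W_ge: "(sqrt ?n + t * sqrt ?d)\<^sup>2 \<le> W" using B p unfolding W_def by linarith
  \<comment> \<open>This makes \<open>K\<close> nonnegative, and through \<open>?n < W\<close> also
    \<open>l\<close>.\<close>
  have "?n + \<tau> * ?d \<le> W"
  proof -
    have "?n = (sqrt ?n)\<^sup>2" by simp
    also have "\<dots> \<le> (sqrt ?n + t * sqrt ?d)\<^sup>2" using t by (intro power_mono) auto
    finally show ?thesis unfolding W_def p_def B using X by (simp only: left_diff_distrib)
  qed
  then have W: "?n + \<tau> * ?d \<le> W" "?n < W" using \<tau> d by (auto intro: less_le_trans[rotated])
  define s where "s = - \<tau> / (2 * (1 - \<tau>))"
  have s: "s < 0" "1 - 2 * s = 1 / (1 - \<tau>)" "s * p = - \<tau> * ?d / 2"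
    using \<tau> by (auto simp: s_def p_def field_simps)
  define l where "l = (1 - ?n / W) / 2"
  have l: "0 \<le> l" "l < 1 / 2" "1 - 2 * l = ?n / W" "l * W = (W - ?n) / 2"
    using W n by (auto simp: l_def field_simps)
  define K where "K = (W - ?n - \<tau> * ?d) / 2"
  define N where "N A = (norm (sgn (to_mat A *v u :: real^'d) v* to_mat A))\<^sup>2" for A
  have [measurable]: "N \<in> borel_measurable (\<Pi>\<^sub>M ij\<in>UNIV. borel)"
    unfolding N_def by (rule borel_measurable_sgn_mult_to_mat)
  have "N \<in> borel_measurable ?G" "(\<lambda>A. (norm (to_mat A *v u :: real^'d))\<^sup>2) \<in> borel_measurable ?G"
    by measurable
  then show S: "S \<in> sets ?G"
    unfolding S_def N_def[symmetric]
    by (intro sets.sets_Collect_conj borel_measurable_le borel_measurable_times borel_measurable_const)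
  have "emeasure ?G S \<le> ennreal (exp (- K) *
      ((1 / sqrt (1 - 2 * s)) ^ CARD('d) * (1 / sqrt (1 - 2 * l)) ^ CARD('n)))"
  proof (rule emeasure_std_gaussian_chernoff[OF l(1,2) _ u S])
    fix A assume A: "A \<in> S"
    define a where "a = (norm (to_mat A *v u))\<^sup>2"
    have a: "p \<le> a" "B\<^sup>2 * a \<le> p * N A" using A by (auto simp: S_def a_def N_def p_def)
    \<comment> \<open>Inserting the lower bound for \<open>N A - a\<close> makes the exponent at
      least \<open>m * a\<close>. Since \<open>m * p = K\<close> with \<open>0 \<le> K\<close>, the
      slope \<open>m\<close> is nonnegative, and \<open>p \<le> a\<close> gives
      \<open>K\<close>.\<close>
    define m where "m = s + l * W / p"
    have mp: "m * p = K" using p s l by (simp add: m_def K_def field_simps)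
    moreover have "0 \<le> K" using W by (simp add: K_def)
    ultimately have m: "0 \<le> m" using p by (metis zero_le_mult_iff not_le)
    have "K \<le> m * a" unfolding mp[symmetric] using a m by (intro mult_left_mono)
    also have "\<dots> = s * a + l * (W / p * a)" by (simp add: m_def algebra_simps)
    also have "\<dots> \<le> s * a + l * (N A - a)"
    proof -
      have "W / p * a = B\<^sup>2 * a / p - a" using p by (simp add: W_def field_simps)
      also have "\<dots> \<le> N A - a" using a p by (simp add: field_simps)
      finally show ?thesis using l(1) by (intro add_left_mono mult_left_mono)
    qed
    finally show "K \<le> s * (norm (to_mat A *v u))\<^sup>2 +
      l * ((norm (sgn (to_mat A *v u) v* to_mat A))\<^sup>2 - (norm (to_mat A *v u))\<^sup>2)"
      by (simp only: a_def N_def)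
  qed (use s in simp)
  also have "(1 / sqrt (1 - 2 * s)) ^ CARD('d) = exp (?d / 2 * ln (1 - \<tau>))"
    unfolding s using \<tau> by (simp add: power_inverse_sqrt_eq_exp ln_div)
  also have "(1 / sqrt (1 - 2 * l)) ^ CARD('n) = exp (?n / 2 * ln (W / ?n))"
  proof -
    have "ln (?n / W) = - ln (W / ?n)" using W n by (simp add: ln_div)
    then show ?thesis unfolding l(3) using W n by (simp add: power_inverse_sqrt_eq_exp)
  qed
  also have "exp (- K) * (exp (?d / 2 * ln (1 - \<tau>)) * exp (?n / 2 * ln (W / ?n)))
    = exp (?d / 2 * (\<tau> + ln (1 - \<tau>))) * exp (?n / 2 * ln (W / ?n) - (W - ?n) / 2)"
    by (simp add: K_def field_simps flip: exp_add)
  also have "ennreal (exp (?d / 2 * (\<tau> + ln (1 - \<tau>))) * exp (?n / 2 * ln (W / ?n) - (W - ?n) / 2))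
    \<le> ennreal (exp (?d / 2 * (\<tau> + ln (1 - \<tau>))) * exp (- ?d * t\<^sup>2 / 2))"
  proof (rule ennreal_leI)
    \<comment> \<open>With \<open>W = y\<^sup>2\<close>, the inequality
      \<open>ln x \<le> x - 1\<close> at \<open>x = y / sqrt ?n\<close> bounds the second exponent
      by \<open>- (y - sqrt ?n)\<^sup>2 / 2\<close>, and \<open>y\<close> exceeds
      \<open>sqrt ?n\<close> by at least \<open>t * sqrt ?d\<close>.\<close>
    define y where "y = sqrt W"
    have y: "sqrt ?n + t * sqrt ?d \<le> y" "W = y\<^sup>2" "0 < y"
      using W_ge W n by (auto simp: y_def intro: real_le_rsqrt)
    have "ln (W / ?n) = 2 * ln (y / sqrt ?n)"
      using y n by (simp add: y(2) ln_div ln_realpow ln_sqrt)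
    also have "\<dots> \<le> 2 * (y / sqrt ?n - 1)"
      using y n by (intro mult_left_mono ln_le_minus_one divide_pos_pos) auto
    finally have "?n / 2 * ln (W / ?n) \<le> ?n / 2 * (2 * (y / sqrt ?n - 1))"
      by (intro mult_left_mono) auto
    also have "\<dots> = (?n / sqrt ?n) * y - ?n"
      by (simp add: right_diff_distrib)
    also have "\<dots> = sqrt ?n * y - ?n"
      by (simp add: real_div_sqrt)
    finally have "?n / 2 * ln (W / ?n) - (W - ?n) / 2 \<le> - (y - sqrt ?n)\<^sup>2 / 2"
      using n by (simp add: y(2) power2_diff field_simps)
    also have "\<dots> \<le> - (t * sqrt ?d)\<^sup>2 / 2"
      using y t by (simp add: power_mono)
    also have "\<dots> = - ?d * t\<^sup>2 / 2" by (simp add: power_mult_distrib)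
    finally show "exp (?d / 2 * (\<tau> + ln (1 - \<tau>))) * exp (?n / 2 * ln (W / ?n) - (W - ?n) / 2)
      \<le> exp (?d / 2 * (\<tau> + ln (1 - \<tau>))) * exp (- ?d * t\<^sup>2 / 2)" by simp
  qed
  finally show "emeasure ?G S \<le> ennreal (exp (?d / 2 * (\<tau> + ln (1 - \<tau>))) * exp (- ?d * t\<^sup>2 / 2))" .
qed

section \<open>The noise event and measurability of the error event\<close>

lemma sets_gaussian_noise_measure [measurable_cong]:
  "sets (gaussian_noise_measure \<sigma> :: ('d::finite \<Rightarrow> real) measure) = sets (\<Pi>\<^sub>M i\<in>UNIV. borel)"
  unfolding gaussian_noise_measure_def by (intro sets_PiM_cong) auto

lemma prob_space_gaussian_noise_measure:
  "0 < \<sigma> \<Longrightarrow> prob_space (gaussian_noise_measure \<sigma> :: ('d::finite \<Rightarrow> real) measure)"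
  unfolding gaussian_noise_measure_def by (intro prob_space_PiM prob_space_normal_density)

lemma borel_measurable_to_vec [measurable]:
  "(\<lambda>z. to_vec z :: real^'d::finite) \<in> borel_measurable (\<Pi>\<^sub>M i\<in>UNIV. borel)"
  unfolding to_vec_def by measurable

text \<open>The noise is independent of the matrix, so for each fixed \<open>A\<close> the direction
  is a constant vector of norm at most 1; the tail bound for the noise is then integrated over
  \<open>A\<close>.\<close>

lemma emeasure_noise_correlation_le:
  fixes u :: "real^'n::finite" and \<sigma> \<gamma> :: real
  assumes pos: "0 < \<sigma>" "0 < \<gamma>"
  defines "M \<equiv> (std_gaussian UNIV :: ('d::finite \<times> 'n \<Rightarrow> real) measure) \<Otimes>\<^sub>M gaussian_noise_measure \<sigma>"
  defines "S \<equiv> {\<omega> \<in> space M. \<gamma> * \<sigma> \<le> - sgn (to_mat (fst \<omega>) *v u) \<bullet> to_vec (snd \<omega>)}"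
  shows "S \<in> sets M" and "emeasure M S \<le> ennreal (exp (- \<gamma>\<^sup>2 / 2))"
proof -
  let ?G = "std_gaussian UNIV :: ('d \<times> 'n \<Rightarrow> real) measure"
  let ?Z = "gaussian_noise_measure \<sigma> :: ('d \<Rightarrow> real) measure"
  interpret G: prob_space ?G by (rule prob_space_std_gaussian)
  interpret Z: prob_space ?Z by (rule prob_space_gaussian_noise_measure) (rule pos)
  have [measurable]: "(\<lambda>A. sgn (to_mat A *v u :: real^'d)) \<in> borel_measurable (\<Pi>\<^sub>M ij\<in>UNIV. borel)"
    unfolding sgn_div_norm by measurable
  show S: "S \<in> sets M" unfolding S_def M_def by measurable
  have "emeasure M S = (\<integral>\<^sup>+A. emeasure ?Z (Pair A -` S) \<partial>?G)"
    unfolding M_def by (rule Z.emeasure_pair_measure_alt[OF S[unfolded M_def]])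
  also have "\<dots> \<le> (\<integral>\<^sup>+A. ennreal (exp (- \<gamma>\<^sup>2 / 2)) \<partial>?G)"
  proof (rule nn_integral_mono)
    fix A assume A: "A \<in> space ?G"
    define w where "w i = - sgn (to_mat A *v u) $ i" for i
    have "Pair A -` S = {z \<in> space ?Z. \<gamma> * \<sigma> \<le> (\<Sum>i\<in>UNIV. w i * z i)}"
      using A by (auto simp: S_def M_def space_pair_measure w_def inner_vec_def to_vec_def)
    moreover have "(\<Sum>i\<in>UNIV. (w i)\<^sup>2) = (norm (sgn (to_mat A *v u)))\<^sup>2"
      by (simp add: power2_norm_vec w_def)
    then have "(\<Sum>i\<in>UNIV. (w i)\<^sup>2) \<le> 1" by (simp add: norm_sgn split: if_splits)
    ultimately show "emeasure ?Z (Pair A -` S) \<le> ennreal (exp (- \<gamma>\<^sup>2 / 2))"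
      using emeasure_noise_tail_le[of \<sigma> \<gamma> w] pos by simp
  qed
  also have "\<dots> = ennreal (exp (- \<gamma>\<^sup>2 / 2))" by (simp add: G.emeasure_space_1)
  finally show "emeasure M S \<le> ennreal (exp (- \<gamma>\<^sup>2 / 2))" .
qed

lemma continuous_on_matrix_vector_mult [continuous_intros]:
  fixes A :: "'a::topological_space \<Rightarrow> real^'n::finite^'d::finite"
  assumes "continuous_on S A" "continuous_on S x"
  shows "continuous_on S (\<lambda>p. A p *v x p)"
  unfolding matrix_vector_mult_def using assms by (intro continuous_intros)

text \<open>The existential over \<open>Q\<close> may be uncountable. For each fixed
  \<open>xh\<close> the conditions define a closed set of triples of point, matrix and noise, and
  its projection along the compact \<open>Q\<close> is closed; the event is a finite union of
  preimages of such projections.\<close>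

lemma sets_least_squares_event:
  fixes Q C :: "(real^'n::finite) set" and b :: real
    and M :: "(('d::finite \<times> 'n \<Rightarrow> real) \<times> ('d \<Rightarrow> real)) measure"
  assumes Q: "compact Q" and C: "finite C"
    and M [measurable_cong]: "sets M = sets ((\<Pi>\<^sub>M ij\<in>UNIV. borel) \<Otimes>\<^sub>M (\<Pi>\<^sub>M i\<in>UNIV. borel))"
  shows "{\<omega> \<in> space M. \<exists>xo\<in>Q. \<exists>xh\<in>C.
    (\<forall>c\<in>C. (norm (to_mat (fst \<omega>) *v xo + to_vec (snd \<omega>) - to_mat (fst \<omega>) *v xh))\<^sup>2
       \<le> (norm (to_mat (fst \<omega>) *v xo + to_vec (snd \<omega>) - to_mat (fst \<omega>) *v c))\<^sup>2)
    \<and> norm (xo - xh) \<ge> b} \<in> sets M" (is "?E \<in> _")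
proof -
  define \<Phi> where "\<Phi> \<omega> = (to_mat (fst \<omega>) :: real^'n^'d, to_vec (snd \<omega>) :: real^'d)"
    for \<omega> :: "('d \<times> 'n \<Rightarrow> real) \<times> ('d \<Rightarrow> real)"
  define T where "T xh = {p :: (real^'n) \<times> ((real^'n^'d) \<times> (real^'d)).
    (\<forall>c\<in>C. (norm (fst (snd p) *v fst p + snd (snd p) - fst (snd p) *v xh))\<^sup>2
       \<le> (norm (fst (snd p) *v fst p + snd (snd p) - fst (snd p) *v c))\<^sup>2)
    \<and> b \<le> norm (fst p - xh)}" for xh
  have "closed (T xh)" for xh
    unfolding T_def Ball_def
    by (intro closed_Collect_conj closed_Collect_all closed_Collect_imp open_Collect_const
        closed_Collect_le continuous_intros)
  then have closed: "closed {y. \<exists>x. x \<in> Q \<and> (x, y) \<in> T xh}" for xh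
    by (rule closed_compact_projection[OF Q])
  have [measurable]: "\<Phi> \<in> measurable M borel"
    unfolding \<Phi>_def to_mat_def to_vec_def by measurable
  have "?E = (\<Union>xh\<in>C. \<Phi> -` {y. \<exists>x. x \<in> Q \<and> (x, y) \<in> T xh} \<inter> space M)"
    by (auto simp: T_def \<Phi>_def)
  also have "\<dots> \<in> sets M"
    using C closed by (intro sets.finite_UN measurable_sets[of \<Phi> M borel] borel_closed) auto
  finally show ?thesis .
qed

section \<open>The union bound over pairs of codewords\<close>

theorem theorem8:
  fixes Q :: "(real^'n::finite) set"
    and E :: "real^'n \<Rightarrow> nat" and D :: "nat \<Rightarrow> real^'n"
    and r :: nat and \<sigma> \<tau> t \<gamma> :: real
  assumes "compact Q"
    and "is_compression_code Q r E D"
    and "\<sigma> > 0"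
    and "0 < \<tau>" and "\<tau> < 1" and "t > 0" and "\<gamma> > 0"
  shows
    "let M = (gaussian_matrix_measure :: ('d::finite \<times> 'n \<Rightarrow> real) measure)
               \<Otimes>\<^sub>M (gaussian_noise_measure \<sigma> :: ('d \<Rightarrow> real) measure);
         \<delta> = distortion Q E D;
         C = codebook Q E D;
         n = real CARD('n); d = real CARD('d);
         bound = (2 * (sqrt n + (t + 1) * sqrt d) * \<delta> + 2 * \<gamma> * \<sigma>) / sqrt ((1 - \<tau>) * d) + \<delta>;
         ev = {\<omega> \<in> space M.
                 \<exists>xo\<in>Q. \<exists>xh\<in>C.
                   (\<forall>c\<in>C. (norm (to_mat (fst \<omega>) *v xo + to_vec (snd \<omega>) - to_mat (fst \<omega>) *v xh))\<^sup>2
                            \<le> (norm (to_mat (fst \<omega>) *v xo + to_vec (snd \<omega>) - to_mat (fst \<omega>) *v c))\<^sup>2)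
                   \<and> norm (xo - xh) \<ge> bound}
     in ev \<in> sets M \<and>
        measure M ev \<le> exp (- d * t\<^sup>2 / 2)
                        + 2 ^ (2 * r) * (exp (- \<gamma>\<^sup>2 / 2) + exp (d / 2 * (\<tau> + ln (1 - \<tau>))))"
proof -
  let ?G = "std_gaussian UNIV :: ('d \<times> 'n \<Rightarrow> real) measure"
  let ?Z = "gaussian_noise_measure \<sigma> :: ('d \<Rightarrow> real) measure"
  let ?M = "?G \<Otimes>\<^sub>M ?Z"
  have G: "(gaussian_matrix_measure :: ('d \<times> 'n \<Rightarrow> real) measure) = ?G"
    by (simp add: gaussian_matrix_measure_def std_gaussian_def)
  define \<delta> where "\<delta> = distortion Q E D"
  define C where "C = codebook Q E D"
  define n where "n = real CARD('n)"
  define d where "d = real CARD('d)"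
  define B where "B = sqrt n + (t + 1) * sqrt d"
  define p where "p = (1 - \<tau>) * d"
  define bound where "bound = (2 * (sqrt n + (t + 1) * sqrt d) * \<delta> + 2 * \<gamma> * \<sigma>) / sqrt ((1 - \<tau>) * d) + \<delta>"
  define ev where "ev = {\<omega> \<in> space ?M. \<exists>xo\<in>Q. \<exists>xh\<in>C.
    (\<forall>c\<in>C. (norm (to_mat (fst \<omega>) *v xo + to_vec (snd \<omega>) - to_mat (fst \<omega>) *v xh))\<^sup>2
       \<le> (norm (to_mat (fst \<omega>) *v xo + to_vec (snd \<omega>) - to_mat (fst \<omega>) *v c))\<^sup>2)
    \<and> norm (xo - xh) \<ge> bound}"
  define p1 where "p1 = exp (d / 2 * (\<tau> + ln (1 - \<tau>)))"
  define pt where "pt = exp (- d * t\<^sup>2 / 2)"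
  define pg where "pg = exp (- \<gamma>\<^sup>2 / 2)"
  define R where "R = (2::real) ^ (2 * r)"
  note pos = \<open>\<sigma> > 0\<close> \<open>0 < \<tau>\<close> \<open>\<tau> < 1\<close> \<open>t > 0\<close> \<open>\<gamma> > 0\<close>
  have d: "0 < d" and n: "0 < n" by (simp_all add: d_def n_def)
  have p: "0 < p" using pos d by (simp add: p_def)
  have B: "0 < B" using pos d n by (simp add: B_def add_pos_pos)
  have sub: "C \<subseteq> D ` {1..2 ^ r}"
    using assms(2) by (auto simp: C_def codebook_def is_compression_code_def)
  then have C: "finite C" by (rule finite_subset) simp
  have "card C \<le> card (D ` {1..2 ^ r})" using sub by (rule card_mono[rotated]) simp
  also have "\<dots> \<le> card {1..(2::nat) ^ r}" by (rule card_image_le) simp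
  finally have "card C \<le> 2 ^ r" by simp
  then have "card (C \<times> C) \<le> 2 ^ r * 2 ^ r" by (simp add: card_cartesian_product mult_le_mono)
  then have "real (card (C \<times> C)) \<le> real (2 ^ r * 2 ^ r)" by (rule of_nat_mono)
  then have card: "real (card (C \<times> C)) \<le> R" by (simp add: R_def mult_2 power_add)
  \<comment> \<open>A real supremum is an upper bound only for a bounded family; boundedness comes
    from the compactness of \<open>Q\<close> and the finiteness of the codebook.\<close>
  have \<delta>: "norm (x - D (E x)) \<le> \<delta>" if "x \<in> Q" for x
    unfolding \<delta>_def distortion_def
  proof (rule cSUP_upper[OF that])
    obtain a where a: "\<And>x. x \<in> Q \<Longrightarrow> norm x \<le> a"
      using compact_imp_bounded[OF assms(1)] by (auto simp: bounded_iff)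
    obtain b where b: "\<And>c. c \<in> C \<Longrightarrow> norm c \<le> b"
      using finite_imp_bounded[OF C] by (auto simp: bounded_iff)
    show "bdd_above ((\<lambda>x. norm (x - D (E x))) ` Q)"
    proof (rule bdd_aboveI2)
      fix x assume x: "x \<in> Q"
      then have "norm (D (E x)) \<le> b" by (intro b) (simp add: C_def codebook_def)
      then show "norm (x - D (E x)) \<le> a + b"
        using a[OF x] norm_triangle_ineq4[of x "D (E x)"] by linarith
    qed
  qed
  interpret G: prob_space ?G by (rule prob_space_std_gaussian)
  interpret Z: prob_space ?Z by (rule prob_space_gaussian_noise_measure) (rule pos)
  interpret P: pair_prob_space ?G ?Z ..
  \<comment> \<open>The three alternatives of the deterministic lemma, as events for a direction
    \<open>u\<close>. \<open>E1\<close> and \<open>E3\<close> are cylinders over matrix events, so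
    their probabilities reduce to those of the matrix.\<close>
  define E1 where "E1 u = {A \<in> space ?G. (norm (to_mat A *v u))\<^sup>2 \<le> p} \<times> space ?Z" for u
  define E2 where "E2 u = {\<omega> \<in> space ?M. \<gamma> * \<sigma> \<le> - sgn (to_mat (fst \<omega>) *v u) \<bullet> to_vec (snd \<omega>)}" for u
  define E3 where "E3 u = {A \<in> space ?G. p \<le> (norm (to_mat A *v u))\<^sup>2 \<and>
    B\<^sup>2 * (norm (to_mat A *v u))\<^sup>2 \<le> p * (norm (sgn (to_mat A *v u) v* to_mat A))\<^sup>2} \<times> space ?Z" for u
  have E1: "E1 u \<in> sets ?M" "measure ?M (E1 u) \<le> p1" if "norm u = 1" for u
  proof -
    note small = emeasure_std_gaussian_small_image_le[where 'd='d, OF pos(2,3) that, folded d_def, folded p1_def p_def]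
    show "E1 u \<in> sets ?M" using small(1) by (simp add: E1_def)
    have "emeasure ?M (E1 u) \<le> ennreal p1"
      using small by (simp add: E1_def Z.emeasure_pair_measure_Times Z.emeasure_space_1)
    then show "measure ?M (E1 u) \<le> p1" by (simp add: P.emeasure_eq_measure p1_def)
  qed
  have E2: "E2 u \<in> sets ?M" "measure ?M (E2 u) \<le> pg" for u
    using emeasure_noise_correlation_le[where 'd='d, OF pos(1,5), of u]
    by (simp_all add: E2_def P.emeasure_eq_measure pg_def)
  have E3: "E3 u \<in> sets ?M" "measure ?M (E3 u) \<le> p1 * pt" if "norm u = 1" for u
  proof -
    note unbal = emeasure_std_gaussian_unbalanced_le[where 'd='d, OF pos(2,3,4) that,
      folded d_def n_def, folded p1_def pt_def p_def B_def]
    show "E3 u \<in> sets ?M" using unbal(1) by (simp add: E3_def)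
    have "emeasure ?M (E3 u) \<le> ennreal (p1 * pt)"
      using unbal by (simp add: E3_def Z.emeasure_pair_measure_Times Z.emeasure_space_1)
    then show "measure ?M (E3 u) \<le> p1 * pt" by (simp add: P.emeasure_eq_measure p1_def pt_def)
  qed
  \<comment> \<open>Equal pairs are left out because the matrix bounds need a unit direction,
    whereas \<open>sgn 0 = 0\<close>.\<close>
  define I where "I = {(c, xh) \<in> C \<times> C. c \<noteq> xh}"
  have I: "finite I" "real (card I) \<le> R"
  proof -
    have "I \<subseteq> C \<times> C" by (auto simp: I_def)
    then have "card I \<le> card (C \<times> C)" using C by (intro card_mono) auto
    with card show "real (card I) \<le> R" by linarith
    show "finite I" using \<open>I \<subseteq> C \<times> C\<close> C by (auto intro: finite_subset)
  qed
  define v where "v cx = sgn (fst cx - snd cx)" for cx :: "(real^'n) \<times> (real^'n)"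
  define F where "F cx = E1 (v cx) \<union> E2 (v cx) \<union> E3 (v cx)" for cx
  have v: "norm (v cx) = 1" if "cx \<in> I" for cx
    using that by (auto simp: v_def I_def norm_sgn)
  have F: "F cx \<in> sets ?M" "measure ?M (F cx) \<le> p1 + pg + p1 * pt" if "cx \<in> I" for cx
  proof -
    note [measurable] = E1(1)[OF v[OF that]] E2(1)[of "v cx"] E3(1)[OF v[OF that]]
    show "F cx \<in> sets ?M" unfolding F_def by measurable
    have "measure ?M (F cx) \<le> measure ?M (E1 (v cx) \<union> E2 (v cx)) + measure ?M (E3 (v cx))"
      unfolding F_def by (rule measure_Un_le) measurable
    also have "measure ?M (E1 (v cx) \<union> E2 (v cx)) \<le> measure ?M (E1 (v cx)) + measure ?M (E2 (v cx))"
      by (rule measure_Un_le) measurable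
    finally show "measure ?M (F cx) \<le> p1 + pg + p1 * pt"
      using E1(2)[OF v[OF that]] E2(2)[of "v cx"] E3(2)[OF v[OF that]] by linarith
  qed
  have ev: "ev \<in> sets ?M"
    unfolding ev_def using assms(1) C
    by (rule sets_least_squares_event) (intro sets_pair_measure_cong sets_std_gaussian sets_gaussian_noise_measure)
  have "ev \<subseteq> (\<Union>cx\<in>I. F cx)"
  proof
    fix \<omega> assume "\<omega> \<in> ev"
    then obtain x xh where \<omega>: "\<omega> \<in> space ?M" and x: "x \<in> Q" and xh: "xh \<in> C"
      and le: "\<And>c. c \<in> C \<Longrightarrow> (norm (to_mat (fst \<omega>) *v x + to_vec (snd \<omega>) - to_mat (fst \<omega>) *v xh))\<^sup>2
       \<le> (norm (to_mat (fst \<omega>) *v x + to_vec (snd \<omega>) - to_mat (fst \<omega>) *v c))\<^sup>2"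
      and far: "norm (x - xh) \<ge> bound"
      unfolding ev_def by auto
    define c where "c = D (E x)"
    have c: "c \<in> C" using x by (simp add: c_def C_def codebook_def)
    have far': "(2 * B * \<delta> + 2 * (\<gamma> * \<sigma>)) / sqrt p + \<delta> \<le> norm (x - xh)"
      using far by (simp add: bound_def B_def p_def mult.assoc)
    have "0 < \<gamma> * \<sigma>" using pos by simp
    from least_squares_error_cases[OF le[OF c] \<delta>[OF x, folded c_def] far' B this p]
    have "(c, xh) \<in> I" "\<omega> \<in> F (c, xh)"
      using c xh \<omega> by (auto simp: I_def F_def v_def E1_def E2_def E3_def space_pair_measure)
    then show "\<omega> \<in> (\<Union>cx\<in>I. F cx)" by blast
  qed
  then have "measure ?M ev \<le> measure ?M (\<Union>cx\<in>I. F cx)"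
    using I(1) F(1) by (intro P.finite_measure_mono sets.finite_UN) auto
  also have "\<dots> \<le> (\<Sum>cx\<in>I. measure ?M (F cx))"
    using I(1) F(1) by (intro P.finite_measure_subadditive_finite) auto
  also have "\<dots> \<le> real (card I) * (p1 + pg + p1 * pt)"
    using F(2) by (rule sum_bounded_above)
  also have "\<dots> \<le> R * (p1 + pg + p1 * pt)"
    using I(2) by (intro mult_right_mono) (auto simp: p1_def pg_def pt_def)
  finally have main: "measure ?M ev \<le> R * p1 * pt + R * (pg + p1)"
    by (simp add: algebra_simps)
  text \<open>If \<open>R * p1 > 1\<close>, the claimed bound exceeds 1; otherwise \<open>R * p1\<close> absorbs the union bound over
    the pairs of codewords in the first term.\<close>
  have "measure ?M ev \<le> pt + R * (pg + p1)"
  proof (cases "R * p1 \<le> 1")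
    case True
    then have "R * p1 * pt \<le> pt" by (simp add: pt_def)
    with main show ?thesis by linarith
  next
    case False
    moreover have "0 < pt" "0 < R * pg" by (simp_all add: pt_def pg_def R_def)
    moreover have "measure ?M ev \<le> 1" by (rule P.prob_le_1)
    ultimately show ?thesis unfolding distrib_left by linarith
  qed
  with ev show ?thesis
    unfolding Let_def G ev_def bound_def C_def \<delta>_def n_def d_def pt_def pg_def p1_def R_def by blast
qed

end
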